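(* Let $M$ be a monoid (i.e., a cancellative commutative semigroup with identity). The following conditions are equivalent. (a) Every submonoid of $M$ is a length-factorial monoid (LFM). (b) Every undermonoid of $M$ is an LFM. (c) $M$ is a group and each element of $M$ has finite order.
   Context: "Monoid" means a cancellative and commutative semigroup with identity, written additively. $\mathcal{U}(M)$ is the group of invertible elements of $M$. $\operatorname{gp}(M)$ is the Grothendieck group of $M$ (the group of differences $\{x-y : x,y\in M\}$, in which $M$ embeds); the order of an element of $M$ is its order in $\operatorname{gp}(M)$. A submonoid $N$ of $M$ is an undermonoid of $M$ if $\operatorname{gp}(N)=\operatorname{gp}(M)$, where $\operatorname{gp}(N)$ is identified with the subgroup of $\operatorname{gp}(M)$ generated by $N$. An atom of a monoid $M$ is an element $a\in M\setminus\mathcal{U}(M)$ such that whenever $a=b+c$ with $b,c\in M$, either $b\in\mathcal{U}(M)$ or $c\in\mathcal{U}(M)$; $\mathcal{A}(M)$ is the set of atoms of $M$. $M$ is atomic if every element of $M$ is invertible or a sum of finitely many atoms. For a monoid $M$, let $\mathsf{Z}(M)$ be the free commutative monoid on $\mathcal{A}(M/\mathcal{U}(M))$, and let $\phi\colon\mathsf{Z}(M)\to M/\mathcal{U}(M)$ be the monoid homomorphism that is the identity on $\mathcal{A}(M/\mathcal{U}(M))$. For $b\in M$, set $\mathsf{Z}(b)=\phi^{-1}(b+\mathcal{U}(M))$, and for $\ell\in\mathbb{N}=\{1,2,\dots\}$ set $\mathsf{Z}_\ell(b)=\{z\in\mathsf{Z}(b) : |z|=\ell\}$, where $|z|$ is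 the number of atoms in the formal sum $z$ counted with multiplicity. $M$ is a length-factorial monoid (LFM) if $M$ is atomic and $|\mathsf{Z}_\ell(b)|\le 1$ for all $b\in M$ and $\ell\in\mathbb{N}$. *)

theory Defs
  imports "HOL-Algebra.Algebra" "HOL-Library.Multiset"
begin

text \<open>
  Monoids are cancellative and commutative: the locale \<^locale>\<open>comm_monoid_cancel\<close>.
  They are written multiplicatively, as everywhere in HOL-Algebra.
\<close>

section \<open>Grothendieck group, orders and undermonoids\<close>

text \<open>The class of \<open>(a, b)\<close> stands for the difference \<open>a - b\<close>. By cancellation, the
  relation below is already transitive.\<close>

definition gp_rel :: "('a, 'b) monoid_scheme \<Rightarrow> (('a \<times> 'a) \<times> ('a \<times> 'a)) set" where
  "gp_rel M = {((a, b), (c, d)).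
     a \<in> carrier M \<and> b \<in> carrier M \<and> c \<in> carrier M \<and> d \<in> carrier M \<and>
     a \<otimes>\<^bsub>M\<^esub> d = c \<otimes>\<^bsub>M\<^esub> b}"

definition gp :: "('a, 'b) monoid_scheme \<Rightarrow> ('a \<times> 'a) set monoid" where
  "gp M = \<lparr>carrier = (carrier M \<times> carrier M) // gp_rel M,
           monoid.mult = (\<lambda>P Q. \<Union>p\<in>P. \<Union>q\<in>Q.
             gp_rel M `` {(fst p \<otimes>\<^bsub>M\<^esub> fst q, snd p \<otimes>\<^bsub>M\<^esub> snd q)}),
           one = gp_rel M `` {(\<one>\<^bsub>M\<^esub>, \<one>\<^bsub>M\<^esub>)}\<rparr>"

definition gp_embed :: "('a, 'b) monoid_scheme \<Rightarrow> 'a \<Rightarrow> ('a \<times> 'a) set" where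
  "gp_embed M x = gp_rel M `` {(x, \<one>\<^bsub>M\<^esub>)}"

text \<open>The library's \<^const>\<open>group.ord\<close> is 0 for elements of infinite order.\<close>

definition has_finite_order :: "('a, 'b) monoid_scheme \<Rightarrow> 'a \<Rightarrow> bool" where
  "has_finite_order M x \<longleftrightarrow> group.ord (gp M) (gp_embed M x) \<noteq> 0"

definition undermonoid :: "'a set \<Rightarrow> ('a, 'b) monoid_scheme \<Rightarrow> bool" where
  "undermonoid N M \<longleftrightarrow>
     submonoid N M \<and> generate (gp M) (gp_embed M ` N) = carrier (gp M)"

section \<open>Atoms and factorizations\<close>

definition atoms :: "('a, 'b) monoid_scheme \<Rightarrow> 'a set" where
  "atoms M = {a \<in> carrier M - Units M.
     \<forall>b\<in>carrier M. \<forall>c\<in>carrier M. a = b \<otimes>\<^bsub>M\<^esub> c \<longrightarrow> b \<in> Units M \<or> c \<in> Units M}"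

definition mset_eval :: "('a, 'b) monoid_scheme \<Rightarrow> 'a multiset \<Rightarrow> 'a" where
  "mset_eval M z = (\<Otimes>\<^bsub>M\<^esub>a\<in>set_mset z. a [^]\<^bsub>M\<^esub> count z a)"

definition atomic :: "('a, 'b) monoid_scheme \<Rightarrow> bool" where
  "atomic M \<longleftrightarrow>
     (\<forall>x\<in>carrier M. x \<in> Units M \<or> (\<exists>z. set_mset z \<subseteq> atoms M \<and> x = mset_eval M z))"

text \<open>The quotient \<open>M/U(M)\<close>; \<^const>\<open>FactGroup\<close> only uses the monoid structure.\<close>

definition reduced :: "('a, 'b) monoid_scheme \<Rightarrow> 'a set monoid" where
  "reduced M = M Mod (Units M)"

definition factorization_monoid :: "('a, 'b) monoid_scheme \<Rightarrow> 'a set multiset monoid" where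
  "factorization_monoid M =
     \<lparr>carrier = {z. set_mset z \<subseteq> atoms (reduced M)}, monoid.mult = (+), one = {#}\<rparr>"

definition factorization_hom :: "('a, 'b) monoid_scheme \<Rightarrow> 'a set multiset \<Rightarrow> 'a set" where
  "factorization_hom M = mset_eval (reduced M)"

definition factorizations :: "('a, 'b) monoid_scheme \<Rightarrow> 'a \<Rightarrow> 'a set multiset set" where
  "factorizations M b =
     {z \<in> carrier (factorization_monoid M). factorization_hom M z = Units M #>\<^bsub>M\<^esub> b}"

definition factorizations_of_length ::
    "('a, 'b) monoid_scheme \<Rightarrow> nat \<Rightarrow> 'a \<Rightarrow> 'a set multiset set" where
  "factorizations_of_length M l b = {z \<in> factorizations M b. size z = l}"

definition length_factorial_monoid :: "('a, 'b) monoid_scheme \<Rightarrow> bool" where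
  "length_factorial_monoid M \<longleftrightarrow>
     comm_monoid_cancel M \<and> atomic M \<and>
     (\<forall>b\<in>carrier M. \<forall>l\<ge>1.
        finite (factorizations_of_length M l b) \<and> card (factorizations_of_length M l b) \<le> 1)"

section \<open>The constructions have the expected structure\<close>

context comm_monoid_cancel
begin

lemma gp_rel_equiv: "equiv (carrier G \<times> carrier G) (gp_rel G)"
proof (rule equivI)
  show "gp_rel G \<subseteq> (carrier G \<times> carrier G) \<times> (carrier G \<times> carrier G)"
    by (auto simp: gp_rel_def)
  show "refl_on (carrier G \<times> carrier G) (gp_rel G)"
    by (auto simp: gp_rel_def refl_on_def)
  show "sym (gp_rel G)"
    by (auto simp: gp_rel_def sym_def)
  show "trans (gp_rel G)"
  proof (rule transI)
    fix p q r assume "(p, q) \<in> gp_rel G" "(q, r) \<in> gp_rel G"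
    then obtain a b c d e f where p: "p = (a, b)" "q = (c, d)" "r = (e, f)"
      and c: "a \<in> carrier G" "b \<in> carrier G" "c \<in> carrier G" "d \<in> carrier G"
             "e \<in> carrier G" "f \<in> carrier G"
      and 1: "a \<otimes> d = c \<otimes> b" and 2: "c \<otimes> f = e \<otimes> d"
      by (auto simp: gp_rel_def)
    have "(a \<otimes> f) \<otimes> d = (a \<otimes> d) \<otimes> f" using c by (simp add: m_ac)
    also have "\<dots> = (c \<otimes> f) \<otimes> b" using c 1 by (simp add: m_ac)
    also have "\<dots> = (e \<otimes> b) \<otimes> d" using c 2 by (simp add: m_ac)
    finally have "a \<otimes> f = e \<otimes> b" using c by (meson m_closed r_cancel)
    then show "(p, r) \<in> gp_rel G" using c p by (simp add: gp_rel_def)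
  qed
qed

lemma gp_mult:
  assumes "a \<in> carrier G" "b \<in> carrier G" "c \<in> carrier G" "d \<in> carrier G"
  shows "(gp_rel G `` {(a, b)}) \<otimes>\<^bsub>gp G\<^esub> (gp_rel G `` {(c, d)})
           = gp_rel G `` {(a \<otimes> c, b \<otimes> d)}"
proof -
  have cong: "gp_rel G `` {(a' \<otimes> c', b' \<otimes> d')} = gp_rel G `` {(a \<otimes> c, b \<otimes> d)}"
    if "((a, b), (a', b')) \<in> gp_rel G" "((c, d), (c', d')) \<in> gp_rel G" for a' b' c' d'
  proof (rule sym, rule equiv_class_eq[OF gp_rel_equiv])
    have m: "a' \<in> carrier G" "b' \<in> carrier G" "c' \<in> carrier G" "d' \<in> carrier G"
      and e: "a \<otimes> b' = a' \<otimes> b" "c \<otimes> d' = c' \<otimes> d"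
      using that by (auto simp: gp_rel_def)
    have "(a \<otimes> c) \<otimes> (b' \<otimes> d') = (a \<otimes> b') \<otimes> (c \<otimes> d')"
      using assms m by (simp add: m_ac)
    also have "\<dots> = (a' \<otimes> c') \<otimes> (b \<otimes> d)"
      unfolding e using assms m by (simp add: m_ac)
    finally show "((a \<otimes> c, b \<otimes> d), (a' \<otimes> c', b' \<otimes> d')) \<in> gp_rel G"
      using assms m by (simp add: gp_rel_def)
  qed
  have "((a, b), (a, b)) \<in> gp_rel G" "((c, d), (c, d)) \<in> gp_rel G"
    using assms by (auto simp: gp_rel_def)
  then have ne: "gp_rel G `` {(a, b)} \<noteq> {}" "gp_rel G `` {(c, d)} \<noteq> {}" by blast+
  have "gp_rel G `` {(fst p \<otimes> fst q, snd p \<otimes> snd q)} = gp_rel G `` {(a \<otimes> c, b \<otimes> d)}"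
    if "p \<in> gp_rel G `` {(a, b)}" "q \<in> gp_rel G `` {(c, d)}" for p q
    using that cong[of "fst p" "snd p" "fst q" "snd q"] by simp
  then show ?thesis
    unfolding gp_def using ne by (simp cong: SUP_cong_simp)
qed

lemma gp_carrier_iff:
  "P \<in> carrier (gp G) \<longleftrightarrow> (\<exists>a\<in>carrier G. \<exists>b\<in>carrier G. P = gp_rel G `` {(a, b)})"
  by (auto simp: gp_def quotient_def)

lemma gp_one: "\<one>\<^bsub>gp G\<^esub> = gp_rel G `` {(\<one>, \<one>)}"
  by (simp add: gp_def)

lemma gp_class_eq_iff:
  assumes "a \<in> carrier G" "b \<in> carrier G" "c \<in> carrier G" "d \<in> carrier G"
  shows "gp_rel G `` {(a, b)} = gp_rel G `` {(c, d)} \<longleftrightarrow> a \<otimes> d = c \<otimes> b"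
  using eq_equiv_class_iff[OF gp_rel_equiv, of "(a, b)" "(c, d)"] assms
  by (auto simp: gp_rel_def)

theorem gp_comm_group: "comm_group (gp G)"
proof (rule comm_groupI)
  fix P Q R
  assume "P \<in> carrier (gp G)"
  then obtain a b where P: "a \<in> carrier G" "b \<in> carrier G" "P = gp_rel G `` {(a, b)}"
    by (auto simp: gp_carrier_iff)
  show "\<one>\<^bsub>gp G\<^esub> \<otimes>\<^bsub>gp G\<^esub> P = P"
    using P by (simp add: gp_one gp_mult)
  show "\<exists>Q\<in>carrier (gp G). Q \<otimes>\<^bsub>gp G\<^esub> P = \<one>\<^bsub>gp G\<^esub>"
  proof
    show "gp_rel G `` {(b, a)} \<in> carrier (gp G)" using P by (auto simp: gp_carrier_iff)
    show "gp_rel G `` {(b, a)} \<otimes>\<^bsub>gp G\<^esub> P = \<one>\<^bsub>gp G\<^esub>"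
      using P by (simp add: gp_one gp_mult gp_class_eq_iff m_comm)
  qed
  assume "Q \<in> carrier (gp G)"
  then obtain c d where Q: "c \<in> carrier G" "d \<in> carrier G" "Q = gp_rel G `` {(c, d)}"
    by (auto simp: gp_carrier_iff)
  show "P \<otimes>\<^bsub>gp G\<^esub> Q \<in> carrier (gp G)"
    using P Q by (auto simp: gp_mult gp_carrier_iff)
  show "P \<otimes>\<^bsub>gp G\<^esub> Q = Q \<otimes>\<^bsub>gp G\<^esub> P"
    using P Q by (simp add: gp_mult m_comm)
  assume "R \<in> carrier (gp G)"
  then obtain e f where R: "e \<in> carrier G" "f \<in> carrier G" "R = gp_rel G `` {(e, f)}"
    by (auto simp: gp_carrier_iff)
  show "P \<otimes>\<^bsub>gp G\<^esub> Q \<otimes>\<^bsub>gp G\<^esub> R = P \<otimes>\<^bsub>gp G\<^esub> (Q \<otimes>\<^bsub>gp G\<^esub> R)"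
    using P Q R by (simp add: gp_mult m_assoc)
next
  show "\<one>\<^bsub>gp G\<^esub> \<in> carrier (gp G)" by (auto simp: gp_one gp_carrier_iff)
qed

theorem gp_embed_hom: "gp_embed G \<in> hom G (gp G)"
proof -
  have "gp_embed G x \<in> carrier (gp G)" if "x \<in> carrier G" for x
    unfolding gp_carrier_iff gp_embed_def using that one_closed by blast
  then show ?thesis by (auto simp: hom_def gp_embed_def gp_mult)
qed

theorem gp_embed_inj: "inj_on (gp_embed G) (carrier G)"
  by (auto simp: inj_on_def gp_embed_def gp_class_eq_iff)

theorem gp_differences:
  assumes "P \<in> carrier (gp G)"
  shows "\<exists>a\<in>carrier G. \<exists>b\<in>carrier G. P = gp_embed G a \<otimes>\<^bsub>gp G\<^esub> inv\<^bsub>gp G\<^esub> gp_embed G b"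
proof -
  interpret A: comm_group "gp G" by (rule gp_comm_group)
  obtain a b where P: "a \<in> carrier G" "b \<in> carrier G" "P = gp_rel G `` {(a, b)}"
    using assms by (auto simp: gp_carrier_iff)
  have m: "gp_embed G a \<in> carrier (gp G)" "gp_embed G b \<in> carrier (gp G)"
    using gp_embed_hom P by (auto simp: hom_def)
  have "P \<otimes>\<^bsub>gp G\<^esub> gp_embed G b = gp_embed G a"
    using P by (simp add: gp_embed_def gp_mult gp_class_eq_iff m_comm)
  then have "P = gp_embed G a \<otimes>\<^bsub>gp G\<^esub> inv\<^bsub>gp G\<^esub> gp_embed G b"
    using m assms by (metis A.inv_solve_right)
  then show ?thesis using P by blast
qed

lemma mset_eval_empty: "mset_eval G {#} = \<one>"
  by (simp add: mset_eval_def)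

lemma mset_eval_single: "a \<in> carrier G \<Longrightarrow> mset_eval G {#a#} = a"
  by (simp add: mset_eval_def)

lemma mset_eval_union:
  assumes "set_mset z \<subseteq> carrier G" "set_mset w \<subseteq> carrier G"
  shows "mset_eval G (z + w) = mset_eval G z \<otimes> mset_eval G w"
proof -
  let ?A = "set_mset z \<union> set_mset w"
  have ext: "mset_eval G v = (\<Otimes>a\<in>?A. a [^] count v a)" if "set_mset v \<subseteq> ?A" for v
    unfolding mset_eval_def
    by (rule finprod_mono_neutral_cong_left)
       (use that assms in \<open>auto simp: not_in_iff\<close>)
  have "mset_eval G (z + w) = (\<Otimes>a\<in>?A. a [^] count z a \<otimes> a [^] count w a)"
    unfolding ext[of "z + w", simplified]
    by (rule finprod_cong') (use assms in \<open>auto simp: nat_pow_mult\<close>)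
  also have "\<dots> = (\<Otimes>a\<in>?A. a [^] count z a) \<otimes> (\<Otimes>a\<in>?A. a [^] count w a)"
    by (rule finprod_multf) (use assms in auto)
  finally show ?thesis using ext[of z] ext[of w] by simp
qed

lemma reduced_mult:
  assumes "a \<in> carrier G" "b \<in> carrier G"
  shows "(Units G #> a) \<otimes>\<^bsub>reduced G\<^esub> (Units G #> b) = Units G #> (a \<otimes> b)"
proof -
  have "\<exists>w\<in>Units G. (u \<otimes> a) \<otimes> (v \<otimes> b) = w \<otimes> (a \<otimes> b)"
    if "u \<in> Units G" "v \<in> Units G" for u v
    using that assms by (intro bexI[of _ "u \<otimes> v"]) (auto simp: m_ac Units_closed)
  moreover have "u \<otimes> (a \<otimes> b) = (u \<otimes> a) \<otimes> (\<one> \<otimes> b)" if "u \<in> Units G" for u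
    using that assms by (auto simp: m_ac Units_closed)
  moreover have "u \<otimes> a \<in> Units G #> a" "\<one> \<otimes> b \<in> Units G #> b" if "u \<in> Units G" for u
    using that by (auto simp: r_coset_def)
  ultimately show ?thesis
    unfolding reduced_def FactGroup_def
    by (auto simp: set_mult_def r_coset_def)
qed

lemma reduced_carrier_iff:
  "P \<in> carrier (reduced G) \<longleftrightarrow> (\<exists>a\<in>carrier G. P = Units G #> a)"
  by (auto simp: reduced_def FactGroup_def RCOSETS_def)

lemma reduced_one: "\<one>\<^bsub>reduced G\<^esub> = Units G #> \<one>"
  by (auto simp: reduced_def FactGroup_def r_coset_def Units_closed)

lemma reduced_eq_iff:
  assumes "a \<in> carrier G" "b \<in> carrier G"
  shows "Units G #> a = Units G #> b \<longleftrightarrow> (\<exists>u\<in>Units G. a = u \<otimes> b)"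
proof
  assume "Units G #> a = Units G #> b"
  moreover have "a \<in> Units G #> a" using assms by (force simp: r_coset_def)
  ultimately show "\<exists>u\<in>Units G. a = u \<otimes> b" by (auto simp: r_coset_def)
next
  assume "\<exists>u\<in>Units G. a = u \<otimes> b"
  then obtain u where u: "u \<in> Units G" "a = u \<otimes> b" by blast
  have 1: "w \<otimes> a = (w \<otimes> u) \<otimes> b" if "w \<in> Units G" for w
    using that u assms by (simp add: m_assoc Units_closed)
  have 2: "w \<otimes> b = (w \<otimes> inv u) \<otimes> a" if "w \<in> Units G" for w
  proof -
    have "(w \<otimes> inv u) \<otimes> a = w \<otimes> ((inv u \<otimes> u) \<otimes> b)"
      unfolding u(2) using that u(1) assms by (simp only: m_assoc Units_closed Units_inv_Units m_closed)
    then show ?thesis using u assms that by (simp add: Units_closed)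
  qed
  show "Units G #> a = Units G #> b"
  proof
    show "Units G #> a \<subseteq> Units G #> b"
    proof
      fix x assume "x \<in> Units G #> a"
      then obtain w where "w \<in> Units G" "x = w \<otimes> a" by (auto simp: r_coset_def)
      then have "w \<otimes> u \<in> Units G" "x = (w \<otimes> u) \<otimes> b"
        using u(1) by (simp_all only: 1 Units_m_closed Units_inv_Units)
      then show "x \<in> Units G #> b" unfolding r_coset_def by blast
    qed
    show "Units G #> b \<subseteq> Units G #> a"
    proof
      fix x assume "x \<in> Units G #> b"
      then obtain w where "w \<in> Units G" "x = w \<otimes> b" by (auto simp: r_coset_def)
      then have "w \<otimes> inv u \<in> Units G" "x = (w \<otimes> inv u) \<otimes> a"
        using u(1) by (simp_all only: 2 Units_m_closed Units_inv_Units)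
      then show "x \<in> Units G #> a" unfolding r_coset_def by blast
    qed
  qed
qed

theorem reduced_comm_monoid_cancel: "comm_monoid_cancel (reduced G)"
proof (rule comm_monoid_cancelI)
  show "comm_monoid (reduced G)"
  proof (rule comm_monoidI)
    fix P Q R
    show "\<one>\<^bsub>reduced G\<^esub> \<in> carrier (reduced G)"
      unfolding reduced_one reduced_carrier_iff using one_closed by blast
    assume "P \<in> carrier (reduced G)"
    then obtain a where a: "a \<in> carrier G" "P = Units G #> a"
      by (auto simp: reduced_carrier_iff)
    show "\<one>\<^bsub>reduced G\<^esub> \<otimes>\<^bsub>reduced G\<^esub> P = P"
      using a by (simp add: reduced_one reduced_mult)
    assume "Q \<in> carrier (reduced G)"
    then obtain b where b: "b \<in> carrier G" "Q = Units G #> b"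
      by (auto simp: reduced_carrier_iff)
    show "P \<otimes>\<^bsub>reduced G\<^esub> Q \<in> carrier (reduced G)"
      unfolding a(2) b(2) reduced_mult[OF a(1) b(1)] reduced_carrier_iff using a(1) b(1) by blast
    show "P \<otimes>\<^bsub>reduced G\<^esub> Q = Q \<otimes>\<^bsub>reduced G\<^esub> P"
      using a b by (simp add: reduced_mult m_comm[of a b])
    assume "R \<in> carrier (reduced G)"
    then obtain c where c: "c \<in> carrier G" "R = Units G #> c"
      by (auto simp: reduced_carrier_iff)
    show "P \<otimes>\<^bsub>reduced G\<^esub> Q \<otimes>\<^bsub>reduced G\<^esub> R = P \<otimes>\<^bsub>reduced G\<^esub> (Q \<otimes>\<^bsub>reduced G\<^esub> R)"
      using a b c by (simp add: reduced_mult m_assoc)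
  qed
next
  fix P Q R
  assume eq: "P \<otimes>\<^bsub>reduced G\<^esub> R = Q \<otimes>\<^bsub>reduced G\<^esub> R"
    and "P \<in> carrier (reduced G)" "Q \<in> carrier (reduced G)" "R \<in> carrier (reduced G)"
  then obtain a b c where m: "a \<in> carrier G" "b \<in> carrier G" "c \<in> carrier G"
    and P: "P = Units G #> a" "Q = Units G #> b" "R = Units G #> c"
    by (auto simp: reduced_carrier_iff)
  obtain u where u: "u \<in> Units G" "a \<otimes> c = u \<otimes> (b \<otimes> c)"
    using eq m unfolding P by (auto simp: reduced_mult reduced_eq_iff)
  then have "a \<otimes> c = (u \<otimes> b) \<otimes> c" using m by (simp add: m_assoc Units_closed)
  then have "a = u \<otimes> b" using m u by (meson Units_closed m_closed r_cancel)
  then show "P = Q" using m u P by (auto simp: reduced_eq_iff)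
qed

theorem factorization_hom_hom:
  "factorization_hom G \<in> hom (factorization_monoid G) (reduced G)"
proof -
  interpret Red: comm_monoid_cancel "reduced G" by (rule reduced_comm_monoid_cancel)
  have "mset_eval (reduced G) z \<in> carrier (reduced G)"
    if "set_mset z \<subseteq> atoms (reduced G)" for z
    unfolding mset_eval_def by (rule Red.finprod_closed) (use that in \<open>auto simp: atoms_def\<close>)
  then show ?thesis
    by (auto simp: hom_def factorization_monoid_def factorization_hom_def atoms_def
             intro!: Red.mset_eval_union)
qed

theorem factorization_hom_one:
  "factorization_hom G \<one>\<^bsub>factorization_monoid G\<^esub> = \<one>\<^bsub>reduced G\<^esub>"
  by (simp add: factorization_monoid_def factorization_hom_def
      comm_monoid_cancel.mset_eval_empty[OF reduced_comm_monoid_cancel])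

theorem factorization_hom_atom:
  "a \<in> atoms (reduced G) \<Longrightarrow> factorization_hom G {#a#} = a"
  by (simp add: factorization_hom_def atoms_def
      comm_monoid_cancel.mset_eval_single[OF reduced_comm_monoid_cancel])

end

end

theory Submission
  imports Defs
begin

text \<open>
  If \<open>M\<close> is a torsion group, then a submonoid contains with \<open>x\<close> all powers of \<open>x\<close>, among them
  the inverse. So every submonoid is a group, has no atoms modulo units, and is trivially length-factorial.

  The converse rests on one construction. Let \<open>P\<close> be a submonoid of \<open>M\<close> and let \<open>a \<in> P\<close> have no
  inverse in \<open>P\<close>. Put \<open>N = {\<one>} \<union> a\<^sup>3 P\<close>. A product of two nontrivial elements of \<open>N\<close> lies in \<open>a\<^sup>6 P\<close>,
  and this set contains none of \<open>a\<^sup>3\<close>, \<open>a\<^sup>4\<close>, \<open>a\<^sup>5\<close>, since otherwise \<open>a\<close> would be invertible in \<open>P\<close>.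
  These three powers are therefore distinct atoms of \<open>N\<close>, whose only unit is \<open>\<one>\<close>, and
  \<open>a\<^sup>3 \<cdot> a\<^sup>5 = a\<^sup>4 \<cdot> a\<^sup>4\<close> gives two factorizations of length 2 of the same element. Moreover every
  quotient \<open>p / q\<close> with \<open>p, q \<in> P\<close> is also the quotient \<open>a\<^sup>3 p / a\<^sup>3 q\<close> of elements of \<open>N\<close>, so \<open>N\<close> is an
  undermonoid as soon as every element of \<open>M\<close> is a quotient of elements of \<open>P\<close>
  (\<open>not_all_undermonoids_length_factorial\<close>).

  It remains to find \<open>P\<close> when \<open>M\<close> is not a torsion group. If \<open>M\<close> has a noninvertible element, it
  can serve as \<open>a\<close>, with \<open>P = M\<close>. If \<open>M\<close> is a group with an element \<open>a\<close> of infinite order, take \<open>P\<close>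
  maximal among the submonoids that contain \<open>a\<close> but in which \<open>a\<close> is not invertible. Maximality forces
  \<open>x \<in> P\<close> or \<open>x\<^sup>-\<^sup>1 \<in> P\<close> for every \<open>x\<close>, so \<open>P\<close> is the cone of nonnegative elements of a total preorder on \<open>M\<close>
  and generates \<open>M\<close> (\<open>exists_total_cone\<close>).
\<close>

section \<open>Orders and undermonoids without the Grothendieck group\<close>

context comm_monoid_cancel
begin

lemma gp_embed_closed: "x \<in> carrier G \<Longrightarrow> gp_embed G x \<in> carrier (gp G)"
  using gp_embed_hom by (auto simp: hom_def)

lemma gp_embed_mult:
  "x \<in> carrier G \<Longrightarrow> y \<in> carrier G \<Longrightarrow>
     gp_embed G (x \<otimes> y) = gp_embed G x \<otimes>\<^bsub>gp G\<^esub> gp_embed G y"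
  using gp_embed_hom by (auto simp: hom_def)

lemma gp_embed_one: "gp_embed G \<one> = \<one>\<^bsub>gp G\<^esub>"
  by (simp add: gp_embed_def gp_one)

lemma gp_embed_pow:
  assumes "x \<in> carrier G"
  shows "gp_embed G (x [^] (n::nat)) = gp_embed G x [^]\<^bsub>gp G\<^esub> n"
  by (induction n) (simp_all add: assms gp_embed_one gp_embed_mult)

text \<open>Because \<open>G\<close> embeds in its Grothendieck group, orders can be read off inside \<open>G\<close>.\<close>

lemma has_finite_order_iff:
  assumes "x \<in> carrier G"
  shows "has_finite_order G x \<longleftrightarrow> (\<exists>n::nat. n \<noteq> 0 \<and> x [^] n = \<one>)"
proof -
  interpret A: comm_group "gp G" by (rule gp_comm_group)
  have "gp_embed G x [^]\<^bsub>gp G\<^esub> n = \<one>\<^bsub>gp G\<^esub> \<longleftrightarrow> x [^] n = \<one>" for n :: nat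
    using inj_onD[OF gp_embed_inj, of "x [^] n" \<one>] assms
    by (auto simp flip: gp_embed_pow gp_embed_one)
  then show ?thesis
    unfolding has_finite_order_def A.ord_eq_0[OF gp_embed_closed[OF assms]] by blast
qed

text \<open>The elements \<open>x\<close> of \<open>G\<close> already generate the group of differences, so it is enough to reach
  these from \<open>N\<close>, in the form \<open>x = p / q\<close>. Writing this as \<open>x \<otimes> q = p\<close> keeps it inside \<open>G\<close>.\<close>

lemma undermonoidI:
  assumes "submonoid N G"
    and quot: "\<And>x. x \<in> carrier G \<Longrightarrow> \<exists>p\<in>N. \<exists>q\<in>N. x \<otimes> q = p"
  shows "undermonoid N G"
proof -
  interpret A: comm_group "gp G" by (rule gp_comm_group)
  interpret N: submonoid N G by fact
  have sub: "gp_embed G ` N \<subseteq> carrier (gp G)"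
    using gp_embed_closed by auto
  interpret S: subgroup "generate (gp G) (gp_embed G ` N)" "gp G"
    by (rule A.generate_is_subgroup[OF sub])
  have emb: "gp_embed G x \<in> generate (gp G) (gp_embed G ` N)" if x: "x \<in> carrier G" for x
  proof -
    obtain p q where pq: "p \<in> N" "q \<in> N" "x \<otimes> q = p" using quot[OF x] by blast
    then have "gp_embed G p = gp_embed G x \<otimes>\<^bsub>gp G\<^esub> gp_embed G q"
      using x gp_embed_mult[of x q] by auto
    then have "gp_embed G x = gp_embed G p \<otimes>\<^bsub>gp G\<^esub> inv\<^bsub>gp G\<^esub> gp_embed G q"
      using pq x gp_embed_closed by (intro A.inv_solve_right[THEN iffD2]) auto
    moreover have "gp_embed G p \<in> generate (gp G) (gp_embed G ` N)"
      "gp_embed G q \<in> generate (gp G) (gp_embed G ` N)"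
      using pq by (auto intro: generate.incl)
    ultimately show ?thesis by simp
  qed
  have "carrier (gp G) \<subseteq> generate (gp G) (gp_embed G ` N)"
  proof
    fix P assume "P \<in> carrier (gp G)"
    then obtain a b where "a \<in> carrier G" "b \<in> carrier G"
      "P = gp_embed G a \<otimes>\<^bsub>gp G\<^esub> inv\<^bsub>gp G\<^esub> gp_embed G b"
      using gp_differences by blast
    then show "P \<in> generate (gp G) (gp_embed G ` N)" using emb by simp
  qed
  then show ?thesis
    using A.generate_incl[OF sub] assms(1) by (auto simp: undermonoid_def)
qed

lemma submonoid_comm_monoid_cancel:
  assumes "submonoid N G"
  shows "comm_monoid_cancel (G\<lparr>carrier := N\<rparr>)"
proof (rule comm_monoid_cancelI)
  show "comm_monoid (G\<lparr>carrier := N\<rparr>)" by (rule submonoid_is_comm_monoid[OF assms])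
next
  fix a b c
  assume "a \<otimes>\<^bsub>G\<lparr>carrier := N\<rparr>\<^esub> c = b \<otimes>\<^bsub>G\<lparr>carrier := N\<rparr>\<^esub> c"
    and "a \<in> carrier (G\<lparr>carrier := N\<rparr>)" "b \<in> carrier (G\<lparr>carrier := N\<rparr>)" "c \<in> carrier (G\<lparr>carrier := N\<rparr>)"
  then show "a = b"
    using submonoid.subset[OF assms] r_cancel[of a c b] by auto
qed

lemma Units_if_finite_order:
  assumes "x \<in> carrier G" "n \<noteq> 0" "x [^] (n::nat) = \<one>"
  shows "x \<in> Units G"
proof -
  obtain m where "n = Suc m" using assms(2) not0_implies_Suc by blast
  then have "x [^] m \<otimes> x = \<one>" using assms(3) by simp
  then show ?thesis
    using assms(1) m_comm[of x "x [^] m"] unfolding Units_def by force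
qed

section \<open>Atoms modulo units\<close>

lemma Units_reduced_coset:
  assumes "b \<in> carrier G"
  shows "Units G #> b \<in> Units (reduced G) \<longleftrightarrow> b \<in> Units G"
proof
  assume "Units G #> b \<in> Units (reduced G)"
  then obtain c where c: "c \<in> carrier G"
    "(Units G #> b) \<otimes>\<^bsub>reduced G\<^esub> (Units G #> c) = \<one>\<^bsub>reduced G\<^esub>"
    unfolding Units_def[of "reduced G"] by (auto simp: reduced_carrier_iff)
  then have "b \<otimes> c \<in> Units G"
    using assms by (auto simp: reduced_mult reduced_one reduced_eq_iff)
  then show "b \<in> Units G" using unit_factor assms c by blast
next
  interpret R: comm_monoid_cancel "reduced G" by (rule reduced_comm_monoid_cancel)
  assume "b \<in> Units G"
  then have "Units G #> b = \<one>\<^bsub>reduced G\<^esub>"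
    unfolding reduced_one using assms by (subst reduced_eq_iff) (auto intro: bexI[of _ b])
  then show "Units G #> b \<in> Units (reduced G)" by simp
qed

text \<open>A factorization of the coset of \<open>a\<close> lifts to a factorization of \<open>a\<close> itself, since the unit by which
  the two differ can be absorbed in the first factor.\<close>

lemma atoms_reduced_coset:
  assumes "a \<in> atoms G"
  shows "Units G #> a \<in> atoms (reduced G)"
proof -
  have a: "a \<in> carrier G" "a \<notin> Units G" using assms by (auto simp: atoms_def)
  have irr: "b \<in> Units G \<or> c \<in> Units G"
    if bc: "b \<in> carrier G" "c \<in> carrier G"
      and eq: "Units G #> a = (Units G #> b) \<otimes>\<^bsub>reduced G\<^esub> (Units G #> c)" for b c
  proof -
    obtain u where u: "u \<in> Units G" "a = u \<otimes> (b \<otimes> c)"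
      using eq a bc by (auto simp: reduced_mult reduced_eq_iff)
    then have "a = (u \<otimes> b) \<otimes> c" using bc by (simp add: m_assoc Units_closed)
    then have "u \<otimes> b \<in> Units G \<or> c \<in> Units G"
      using assms u bc unfolding atoms_def by blast
    then show ?thesis
      using u bc unit_factor[of b u] m_comm[of u b] Units_closed by auto
  qed
  have "R \<in> Units (reduced G) \<or> S \<in> Units (reduced G)"
    if RS: "R \<in> carrier (reduced G)" "S \<in> carrier (reduced G)"
      and eq: "Units G #> a = R \<otimes>\<^bsub>reduced G\<^esub> S" for R S
  proof -
    obtain b c where bc: "b \<in> carrier G" "c \<in> carrier G" "R = Units G #> b" "S = Units G #> c"
      using RS by (auto simp: reduced_carrier_iff)
    then show ?thesis using irr[of b c] eq by (simp add: Units_reduced_coset)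
  qed
  then show ?thesis
    using a by (auto simp: atoms_def Units_reduced_coset reduced_carrier_iff)
qed

text \<open>Both sides of \<open>x \<otimes> z = y \<otimes> y\<close> are factorizations of length 2, hence equal up to units. This is the
  obstruction to length-factoriality used below.\<close>

lemma length_factorial_balanced_pair:
  assumes lf: "length_factorial_monoid G"
    and at: "x \<in> atoms G" "y \<in> atoms G" "z \<in> atoms G" and eq: "x \<otimes> z = y \<otimes> y"
  shows "Units G #> x = Units G #> y"
proof -
  interpret R: comm_monoid_cancel "reduced G" by (rule reduced_comm_monoid_cancel)
  let ?F = "factorizations_of_length G 2 (y \<otimes> y)"
  have car: "x \<in> carrier G" "y \<in> carrier G" "z \<in> carrier G" using at by (auto simp: atoms_def)
  have pair: "{#Units G #> s, Units G #> t#} \<in> factorizations_of_length G 2 (s \<otimes> t)"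
    if st: "s \<in> atoms G" "t \<in> atoms G" for s t
  proof -
    have m: "s \<in> carrier G" "t \<in> carrier G" using st by (auto simp: atoms_def)
    then have c: "Units G #> s \<in> carrier (reduced G)" "Units G #> t \<in> carrier (reduced G)"
      by (auto simp: reduced_carrier_iff)
    then have "mset_eval (reduced G) ({#Units G #> s#} + {#Units G #> t#}) = Units G #> (s \<otimes> t)"
      using m by (subst R.mset_eval_union) (simp_all add: R.mset_eval_single reduced_mult)
    then show ?thesis
      using atoms_reduced_coset[OF st(1)] atoms_reduced_coset[OF st(2)]
      by (simp add: factorizations_of_length_def factorizations_def factorization_monoid_def
          factorization_hom_def add_mset_commute)
  qed
  have "finite ?F" "card ?F \<le> 1"
    using lf car by (auto simp: length_factorial_monoid_def)
  then have "{#Units G #> x, Units G #> z#} = {#Units G #> y, Units G #> y#}"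
    using pair[OF at(1,3)] pair[OF at(2,2)] unfolding eq by (auto simp: card_le_Suc0_iff_eq)
  then show ?thesis by (auto simp: add_eq_conv_ex)
qed

lemma length_factorial_if_all_units:
  assumes "carrier G \<subseteq> Units G"
  shows "length_factorial_monoid G"
proof -
  have "atoms (reduced G) = {}"
    using assms Units_reduced_coset by (auto simp: atoms_def reduced_carrier_iff)
  then have "factorizations_of_length G l b = {}" if "l \<ge> 1" for l b
    using that by (auto simp: factorizations_of_length_def factorizations_def factorization_monoid_def)
  then show ?thesis
    using assms comm_monoid_cancel_axioms
    by (auto simp: length_factorial_monoid_def atomic_def)
qed

section \<open>Torsion groups\<close>

lemma length_factorial_submonoid_if_finite_orders:
  assumes "submonoid N G" and fin: "\<And>x. x \<in> carrier G \<Longrightarrow> has_finite_order G x"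
  shows "length_factorial_monoid (G\<lparr>carrier := N\<rparr>)"
proof (rule comm_monoid_cancel.length_factorial_if_all_units)
  interpret H: comm_monoid_cancel "G\<lparr>carrier := N\<rparr>"
    by (rule submonoid_comm_monoid_cancel[OF assms(1)])
  show "comm_monoid_cancel (G\<lparr>carrier := N\<rparr>)" by (rule H.comm_monoid_cancel_axioms)
  show "carrier (G\<lparr>carrier := N\<rparr>) \<subseteq> Units (G\<lparr>carrier := N\<rparr>)"
  proof
    fix x assume x: "x \<in> carrier (G\<lparr>carrier := N\<rparr>)"
    then have "x \<in> carrier G" using submonoid.subset[OF assms(1)] by auto
    then obtain n :: nat where "n \<noteq> 0" "x [^] n = \<one>"
      using fin has_finite_order_iff by blast
    \<comment> \<open>Powers are built from the product and the identity alone, so they agree in \<open>N\<close> and in \<open>G\<close>.\<close>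
    then show "x \<in> Units (G\<lparr>carrier := N\<rparr>)"
      using x H.Units_if_finite_order[of x n] by (simp add: nat_pow_def)
  qed
qed

section \<open>Adjoining the identity to a principal ideal\<close>

definition principal_submonoid :: "'a set \<Rightarrow> 'a \<Rightarrow> 'a set" where
  "principal_submonoid P c = insert \<one> ((\<otimes>) c ` P)"

lemma submonoid_principal_submonoid:
  assumes "submonoid P G" "c \<in> P"
  shows "submonoid (principal_submonoid P c) G"
proof -
  interpret P: submonoid P G by fact
  have mult: "(c \<otimes> p) \<otimes> (c \<otimes> q) \<in> (\<otimes>) c ` P" if "p \<in> P" "q \<in> P" for p q
  proof (rule image_eqI)
    show "(c \<otimes> p) \<otimes> (c \<otimes> q) = c \<otimes> (p \<otimes> (c \<otimes> q))"
      using that assms(2) by (simp add: m_assoc)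
    show "p \<otimes> (c \<otimes> q) \<in> P" using that assms(2) by simp
  qed
  have sub: "principal_submonoid P c \<subseteq> carrier G"
    using assms(2) by (auto simp: principal_submonoid_def)
  show ?thesis
  proof
    fix x y assume x: "x \<in> principal_submonoid P c" and y: "y \<in> principal_submonoid P c"
    then have "x \<in> carrier G" "y \<in> carrier G" using sub by auto
    then show "x \<otimes> y \<in> principal_submonoid P c"
      using x y mult unfolding principal_submonoid_def by (elim insertE imageE) simp_all
  qed (use sub in \<open>simp_all add: principal_submonoid_def\<close>)
qed

context
  fixes P a
  assumes P: "submonoid P G" and a: "a \<in> P" and nonunit: "\<And>p. p \<in> P \<Longrightarrow> a \<otimes> p \<noteq> \<one>"
begin

interpretation P: submonoid P G by (rule P)

lemma pow_mem: "x \<in> P \<Longrightarrow> x [^] (n::nat) \<in> P"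
  by (induction n) auto

lemma pow_nonunit:
  assumes "p \<in> P" "n \<noteq> 0"
  shows "a [^] (n::nat) \<otimes> p \<noteq> \<one>"
proof -
  obtain m where "n = Suc m" using assms(2) not0_implies_Suc by blast
  then have "a [^] n \<otimes> p = a \<otimes> (a [^] m \<otimes> p)"
    using assms(1) a nat_pow_Suc2[of a m] by (simp add: m_assoc)
  then show ?thesis using nonunit assms(1) a pow_mem by simp
qed

lemma Units_principal_submonoid:
  assumes "n \<noteq> 0"
  shows "Units (G\<lparr>carrier := principal_submonoid P (a [^] (n::nat))\<rparr>) = {\<one>}"
proof -
  interpret N: submonoid "principal_submonoid P (a [^] n)" G
    using submonoid_principal_submonoid[OF P pow_mem[OF a]] .
  have "x = \<one>" if x: "x \<in> Units (G\<lparr>carrier := principal_submonoid P (a [^] n)\<rparr>)" for x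
  proof (rule ccontr)
    assume "x \<noteq> \<one>"
    have "x \<in> principal_submonoid P (a [^] n)"
      using x by (simp add: Units_def)
    then obtain p where p: "p \<in> P" "x = a [^] n \<otimes> p"
      using \<open>x \<noteq> \<one>\<close> unfolding principal_submonoid_def by blast
    obtain y where y: "y \<in> principal_submonoid P (a [^] n)" "x \<otimes> y = \<one>"
      using x unfolding Units_def by auto
    then have "y \<in> P" using a pow_mem by (auto simp: principal_submonoid_def)
    then have "a [^] n \<otimes> (p \<otimes> y) = \<one>"
      using p y(2) a m_assoc[of "a [^] n" p y] by simp
    then show False using pow_nonunit assms p(1) \<open>y \<in> P\<close> by simp
  qed
  moreover have "\<one> \<in> Units (G\<lparr>carrier := principal_submonoid P (a [^] n)\<rparr>)"
    unfolding Units_def by simp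
  ultimately show ?thesis by blast
qed

text \<open>Like the integers from \<open>n\<close> to \<open>2 n - 1\<close> in a numerical monoid all of whose nonzero elements
  are at least \<open>n\<close>, these powers are too small to be products of two nontrivial elements.\<close>

lemma pow_atom_principal_submonoid:
  assumes "n \<le> k" "k < 2 * n"
  shows "a [^] (k::nat) \<in> atoms (G\<lparr>carrier := principal_submonoid P (a [^] n)\<rparr>)"
proof -
  have aG: "a \<in> carrier G" using a by simp
  have n: "n \<noteq> 0" "k \<noteq> 0" using assms by auto
  have "a [^] k = a [^] n \<otimes> a [^] (k - n)"
    using assms aG by (simp add: nat_pow_mult)
  then have mem: "a [^] k \<in> principal_submonoid P (a [^] n)"
    using a pow_mem by (simp add: principal_submonoid_def)
  have one: "a [^] k \<noteq> \<one>"
    using pow_nonunit[of \<one> k] n aG by simp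
  have irr: "a [^] k \<noteq> (a [^] n \<otimes> p) \<otimes> (a [^] n \<otimes> q)" if pq: "p \<in> P" "q \<in> P" for p q
  proof
    assume eq: "a [^] k = (a [^] n \<otimes> p) \<otimes> (a [^] n \<otimes> q)"
    have car: "p \<in> carrier G" "q \<in> carrier G" using pq by auto
    have "(a [^] n \<otimes> p) \<otimes> (a [^] n \<otimes> q) = (a [^] n \<otimes> a [^] n) \<otimes> (p \<otimes> q)"
      using car aG by (simp only: m_ac m_closed nat_pow_closed)
    also have "a [^] n \<otimes> a [^] n = a [^] k \<otimes> a [^] (2 * n - k)"
      using assms aG by (simp add: nat_pow_mult mult_2)
    also have "\<dots> \<otimes> (p \<otimes> q) = a [^] k \<otimes> (a [^] (2 * n - k) \<otimes> (p \<otimes> q))"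
      using car aG by (simp only: m_assoc m_closed nat_pow_closed)
    finally have "a [^] k \<otimes> (a [^] (2 * n - k) \<otimes> (p \<otimes> q)) = a [^] k \<otimes> \<one>"
      using aG by (simp flip: eq)
    then have "a [^] (2 * n - k) \<otimes> (p \<otimes> q) = \<one>"
      by (rule l_cancel) (use car aG in auto)
    then show False using pow_nonunit[of "p \<otimes> q" "2 * n - k"] assms pq by simp
  qed
  show ?thesis
    unfolding atoms_def Units_principal_submonoid[OF n(1)]
    using mem one irr by (auto simp: principal_submonoid_def)
qed

lemma not_all_undermonoids_length_factorial:
  assumes quot: "\<And>x. x \<in> carrier G \<Longrightarrow> \<exists>p\<in>P. \<exists>q\<in>P. x \<otimes> q = p"
  shows "\<exists>N. undermonoid N G \<and> \<not> length_factorial_monoid (G\<lparr>carrier := N\<rparr>)"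
proof (intro exI conjI notI)
  \<comment> \<open>The atoms \<open>a\<^sup>n, \<dots>, a\<^bsup>2n-1\<^esup>\<close> must include three consecutive powers, so 3 is the least possible \<open>n\<close>.\<close>
  let ?N = "principal_submonoid P (a [^] (3::nat))"
  let ?H = "G\<lparr>carrier := ?N\<rparr>"
  have aG: "a \<in> carrier G" using a by simp
  have sub: "submonoid ?N G"
    using submonoid_principal_submonoid[OF P pow_mem[OF a]] .
  show "undermonoid ?N G"
  proof (rule undermonoidI[OF sub])
    fix x assume x: "x \<in> carrier G"
    then obtain p q where pq: "p \<in> P" "q \<in> P" "x \<otimes> q = p" using quot by blast
    then have "x \<otimes> (a [^] (3::nat) \<otimes> q) = a [^] (3::nat) \<otimes> p"
      using x aG by (metis P.mem_carrier m_lcomm nat_pow_closed)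
    then show "\<exists>p\<in>?N. \<exists>q\<in>?N. x \<otimes> q = p"
      using pq by (auto simp: principal_submonoid_def)
  qed
  assume lf: "length_factorial_monoid ?H"
  interpret H: comm_monoid_cancel ?H by (rule submonoid_comm_monoid_cancel[OF sub])
  have at: "a [^] k \<in> atoms ?H" if "k \<in> {3, 4, 5}" for k :: nat
    using pow_atom_principal_submonoid[of 3 k] that by auto
  have "a [^] (3::nat) \<otimes>\<^bsub>?H\<^esub> a [^] (5::nat) = a [^] (4::nat) \<otimes>\<^bsub>?H\<^esub> a [^] (4::nat)"
    using aG by (simp add: nat_pow_mult)
  then have "Units ?H #>\<^bsub>?H\<^esub> a [^] (3::nat) = Units ?H #>\<^bsub>?H\<^esub> a [^] (4::nat)"
    using at by (intro H.length_factorial_balanced_pair[OF lf, where z = "a [^] (5::nat)"]) auto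
  then have "a [^] (3::nat) = \<one> \<otimes> a [^] (4::nat)"
    using at[of 3] at[of 4] Units_principal_submonoid[of 3]
    by (subst (asm) H.reduced_eq_iff) (auto simp: atoms_def)
  then have "a [^] (3::nat) \<otimes> a = a [^] (3::nat) \<otimes> \<one>"
    using aG nat_pow_Suc[of a 3] by simp
  then have "a = \<one>" by (rule l_cancel) (use aG in auto)
  then show False using nonunit[of \<one>] by simp
qed

end

section \<open>Total cones in groups\<close>

text \<open>This is the step that orders a group with an element of infinite order: \<open>P\<close> is the set of
  nonnegative elements for a total preorder that makes \<open>a\<close> strictly positive.\<close>

lemma exists_total_cone:
  assumes "group G" and a: "a \<in> carrier G" and inf: "\<And>n::nat. n \<noteq> 0 \<Longrightarrow> a [^] n \<noteq> \<one>"
  obtains P where "submonoid P G" "a \<in> P" "\<And>p. p \<in> P \<Longrightarrow> a \<otimes> p \<noteq> \<one>"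
    "\<And>x. x \<in> carrier G \<Longrightarrow> x \<in> P \<or> inv x \<in> P"
proof -
  interpret group G by fact
  define \<A> where "\<A> = {P. submonoid P G \<and> a \<in> P \<and> (\<forall>p\<in>P. a \<otimes> p \<noteq> \<one>)}"
  have "range (\<lambda>n::nat. a [^] n) \<in> \<A>"
  proof -
    have "submonoid (range (\<lambda>n::nat. a [^] n)) G"
    proof
      show "\<one> \<in> range (\<lambda>n::nat. a [^] n)" by (rule range_eqI[of _ _ 0]) simp
    qed (use a in \<open>auto simp: nat_pow_mult\<close>)
    moreover have "a \<in> range (\<lambda>n::nat. a [^] n)" by (rule range_eqI[of _ _ 1]) (simp add: a)
    moreover have "a \<otimes> a [^] n \<noteq> \<one>" for n :: nat
      using inf[of "Suc n"] a by (simp add: m_comm)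
    ultimately show ?thesis unfolding \<A>_def by blast
  qed
  then have "\<A> \<noteq> {}" by blast
  then have "\<exists>P\<in>\<A>. \<forall>Q\<in>\<A>. P \<subseteq> Q \<longrightarrow> Q = P"
  proof (rule subset_Zorn_nonempty)
    fix \<C> assume ne: "\<C> \<noteq> {}" and ch: "subset.chain \<A> \<C>"
    have sub: "submonoid Q G" "a \<in> Q" "\<forall>p\<in>Q. a \<otimes> p \<noteq> \<one>" if "Q \<in> \<C>" for Q
      using that ch by (auto simp: subset_chain_def \<A>_def)
    have "submonoid (\<Union>\<C>) G"
    proof
      show "\<Union>\<C> \<subseteq> carrier G" using sub(1)[THEN submonoid.subset] by auto
      show "\<one> \<in> \<Union>\<C>" using ne sub(1)[THEN submonoid.one_closed] by auto
      fix x y assume "x \<in> \<Union>\<C>" "y \<in> \<Union>\<C>"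
      then obtain A B where "A \<in> \<C>" "x \<in> A" "B \<in> \<C>" "y \<in> B" by blast
      moreover from this have "A \<subseteq> B \<or> B \<subseteq> A" using ch by (auto simp: subset_chain_def)
      ultimately obtain Q where "Q \<in> \<C>" "x \<in> Q" "y \<in> Q" by blast
      then show "x \<otimes> y \<in> \<Union>\<C>" using submonoid.m_closed[OF sub(1)] by auto
    qed
    then show "\<Union>\<C> \<in> \<A>" using ne sub(2,3) unfolding \<A>_def by auto
  qed
  then obtain P where "P \<in> \<A>" and max: "\<forall>Q\<in>\<A>. P \<subseteq> Q \<longrightarrow> Q = P" by blast
  then have P: "submonoid P G" "a \<in> P" "\<And>p. p \<in> P \<Longrightarrow> a \<otimes> p \<noteq> \<one>" unfolding \<A>_def by blast+
  interpret P: submonoid P G by (rule P(1))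
  have pow_P: "p [^] n \<in> P" if "p \<in> P" for p and n :: nat
    using that by (induction n) auto
  \<comment> \<open>If \<open>x \<notin> P\<close>, then \<open>a\<close> becomes invertible in the submonoid generated by \<open>P\<close> and \<open>x\<close>. The exponent
    \<open>k\<close> is nonzero because \<open>a\<close> is not invertible in \<open>P\<close>.\<close>
  have ext: "\<exists>p\<in>P. \<exists>k::nat. k \<noteq> 0 \<and> (a \<otimes> p) \<otimes> x [^] k = \<one>"
    if x: "x \<in> carrier G" "x \<notin> P" for x
  proof -
    define Q where "Q = {p \<otimes> x [^] (k::nat) | p k. p \<in> P}"
    have "submonoid Q G"
    proof
      show "Q \<subseteq> carrier G" using x by (auto simp: Q_def)
      show "\<one> \<in> Q" unfolding Q_def using x by (auto intro!: exI[of _ \<one>] exI[of _ "0::nat"])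
      fix y z assume "y \<in> Q" "z \<in> Q"
      then obtain p q and k l :: nat where
        y: "y = p \<otimes> x [^] k" "p \<in> P" and z: "z = q \<otimes> x [^] l" "q \<in> P"
        unfolding Q_def by blast
      then have "y \<otimes> z = (p \<otimes> q) \<otimes> x [^] (k + l)"
        using x by (simp add: m_ac flip: nat_pow_mult)
      then show "y \<otimes> z \<in> Q" unfolding Q_def using y z by blast
    qed
    moreover have PQ: "P \<subseteq> Q"
    proof
      fix p assume "p \<in> P"
      then show "p \<in> Q" unfolding Q_def by (auto intro!: exI[of _ p] exI[of _ "0::nat"])
    qed
    moreover have "x \<in> Q"
      unfolding Q_def using x by (auto intro!: exI[of _ \<one>] exI[of _ "1::nat"])
    ultimately have "\<exists>y\<in>Q. a \<otimes> y = \<one>"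
      using max x P(2) unfolding \<A>_def by blast
    then obtain p k where pk: "p \<in> P" "a \<otimes> (p \<otimes> x [^] (k::nat)) = \<one>"
      unfolding Q_def by blast
    then have "k \<noteq> 0" using P(3) by (metis P.mem_carrier nat_pow_0 r_one)
    moreover have "(a \<otimes> p) \<otimes> x [^] k = \<one>" using pk a x by (simp add: m_assoc)
    ultimately show ?thesis using pk by blast
  qed
  have "x \<in> P \<or> inv x \<in> P" if x: "x \<in> carrier G" for x
  proof (rule ccontr)
    assume "\<not> (x \<in> P \<or> inv x \<in> P)"
    then obtain p q and k m :: nat where p: "p \<in> P" "k \<noteq> 0" "(a \<otimes> p) \<otimes> x [^] k = \<one>"
      and q: "q \<in> P" "m \<noteq> 0" "(a \<otimes> q) \<otimes> inv x [^] m = \<one>"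
      using ext[OF x] ext[OF inv_closed[OF x]] by blast
    have ap: "a \<otimes> p \<in> P" "a \<otimes> q \<in> P" using P p q by auto
    then have car: "a \<otimes> p \<in> carrier G" "a \<otimes> q \<in> carrier G" by auto
    \<comment> \<open>Raising the two relations to the powers \<open>m\<close> and \<open>k\<close> makes the powers of \<open>x\<close> cancel.\<close>
    have "(a \<otimes> p) [^] m \<otimes> x [^] (k * m) = ((a \<otimes> p) \<otimes> x [^] k) [^] m"
      using car x nat_pow_distrib[of "a \<otimes> p" "x [^] k" m] nat_pow_pow[of x k m] by simp
    then have 1: "(a \<otimes> p) [^] m \<otimes> x [^] (k * m) = \<one>"
      unfolding p(3) by simp
    have "(a \<otimes> q) [^] k \<otimes> inv x [^] (k * m) = ((a \<otimes> q) \<otimes> inv x [^] m) [^] k"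
      using car x nat_pow_distrib[of "a \<otimes> q" "inv x [^] m" k] nat_pow_pow[of "inv x" m k]
      by (simp only: mult.commute[of m k] nat_pow_closed inv_closed)
    then have 2: "(a \<otimes> q) [^] k \<otimes> inv x [^] (k * m) = \<one>"
      unfolding q(3) by simp
    have 3: "x [^] (k * m) \<otimes> inv x [^] (k * m) = \<one>"
      using x nat_pow_distrib[of x "inv x" "k * m"] by simp
    have "(a \<otimes> p) [^] m \<otimes> (a \<otimes> q) [^] k =
        ((a \<otimes> p) [^] m \<otimes> (a \<otimes> q) [^] k) \<otimes> (x [^] (k * m) \<otimes> inv x [^] (k * m))"
      unfolding 3 using car by simp
    also have "\<dots> = ((a \<otimes> p) [^] m \<otimes> x [^] (k * m)) \<otimes> ((a \<otimes> q) [^] k \<otimes> inv x [^] (k * m))"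
      using car x by (simp only: m_ac m_closed nat_pow_closed inv_closed)
    finally have "(a \<otimes> p) [^] m \<otimes> (a \<otimes> q) [^] k = \<one>"
      unfolding 1 2 by simp
    moreover obtain m' where m': "m = Suc m'" using q(2) not0_implies_Suc by blast
    ultimately have "(a \<otimes> p) \<otimes> (a \<otimes> p) [^] m' \<otimes> (a \<otimes> q) [^] k = \<one>"
      using car nat_pow_Suc2[of "a \<otimes> p" m'] by simp
    then have "a \<otimes> (p \<otimes> (a \<otimes> p) [^] m' \<otimes> (a \<otimes> q) [^] k) = \<one>"
      using a p(1) car by (simp only: m_assoc P.mem_carrier m_closed nat_pow_closed)
    moreover have "p \<otimes> (a \<otimes> p) [^] m' \<otimes> (a \<otimes> q) [^] k \<in> P"
      using p(1) ap pow_P by simp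
    ultimately show False using P(3) by blast
  qed
  then show ?thesis using that[OF P] by auto
qed

section \<open>Hereditary length-factoriality\<close>

lemma torsion_group_if_undermonoids_length_factorial:
  assumes under: "\<And>N. undermonoid N G \<Longrightarrow> length_factorial_monoid (G\<lparr>carrier := N\<rparr>)"
  shows "group G \<and> (\<forall>x\<in>carrier G. has_finite_order G x)"
proof (intro conjI ballI)
  have "x \<in> Units G" if x: "x \<in> carrier G" for x
  proof (rule ccontr)
    assume "x \<notin> Units G"
    then have nonunit: "x \<otimes> p \<noteq> \<one>" if "p \<in> carrier G" for p
      using unit_factor[of x p] x that by auto
    have "submonoid (carrier G) G" by unfold_locales auto
    moreover have "\<exists>p\<in>carrier G. \<exists>q\<in>carrier G. y \<otimes> q = p" if "y \<in> carrier G" for y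
      using that by blast
    ultimately show False
      using not_all_undermonoids_length_factorial[OF _ x nonunit] under by blast
  qed
  then show G: "group G" by unfold_locales auto
  interpret group G by (rule G)
  fix a assume a: "a \<in> carrier G"
  show "has_finite_order G a"
  proof (rule ccontr)
    assume "\<not> has_finite_order G a"
    then have "a [^] n \<noteq> \<one>" if "n \<noteq> 0" for n :: nat
      using that a has_finite_order_iff by blast
    then obtain P where P: "submonoid P G" "a \<in> P" "\<And>p. p \<in> P \<Longrightarrow> a \<otimes> p \<noteq> \<one>"
      and total: "\<And>x. x \<in> carrier G \<Longrightarrow> x \<in> P \<or> inv x \<in> P"
      using exists_total_cone[OF G a] by metis
    have "\<exists>p\<in>P. \<exists>q\<in>P. x \<otimes> q = p" if x: "x \<in> carrier G" for x
    proof -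
      have "x \<otimes> \<one> = x" "x \<otimes> inv x = \<one>" using x by auto
      then show ?thesis using total[OF x] submonoid.one_closed[OF P(1)] by metis
    qed
    then show False
      using not_all_undermonoids_length_factorial[OF P] under by blast
  qed
qed

end

theorem theorem6p3:
  fixes M :: "('a, 'b) monoid_scheme"
  assumes "comm_monoid_cancel M"
  shows "((\<forall>N. submonoid N M \<longrightarrow> length_factorial_monoid (M\<lparr>carrier := N\<rparr>)) \<longleftrightarrow>
          (\<forall>N. undermonoid N M \<longrightarrow> length_factorial_monoid (M\<lparr>carrier := N\<rparr>))) \<and>
         ((\<forall>N. undermonoid N M \<longrightarrow> length_factorial_monoid (M\<lparr>carrier := N\<rparr>)) \<longleftrightarrow>
          (group M \<and> (\<forall>x\<in>carrier M. has_finite_order M x)))"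
proof -
  interpret comm_monoid_cancel M by fact
  have "undermonoid N M \<Longrightarrow> submonoid N M" for N
    by (simp add: undermonoid_def)
  then show ?thesis
    using torsion_group_if_undermonoids_length_factorial length_factorial_submonoid_if_finite_orders
    by blast
qed

end
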